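(* Consider positions of Version C in which all piles have at most $3$ tokens, with $a_1$ piles of size $1$, $a_2$ piles of size $2$, and $a_3$ piles of size $3$. Such a position is a $\mathcal{P}$-position if and only if at least one of the following holds: \begin{itemize} \item $a_1=0$ and $a_3=0$; \item $(a_1,a_2,a_3)\in\{(0,1,3),(0,2,3),(1,0,2),(1,0,5),(2,0,1)\}$; \item $a_1+2a_2\equiv 0 \pmod 3$ and $(a_1,a_2,a_3)$ is not one of the following exceptions: \begin{itemize} \item $(0,3k,j)$ with $k\geq 0$ an integer and $j\in\{1,2\}$; \item $(1,3k+1,j)$ with $k\geq 0$ an integer and $j\in\{0,1\}$; \item $(2,3k+2,0)$ with $k\geq 0$ an integer; \item $(0,0,4)$, $(0,0,5)$, $(1,1,2)$, $(1,1,3)$, $(1,1,4)$, $(1,1,5)$, $(2,2,3)$, $(3,0,1)$, $(3,0,2)$, $(3,0,5)$. \end{itemize} \end{itemize}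
   Context: Version C is a two-player impartial game. A position consists of finitely many piles of tokens. The players alternate turns; on a turn, a player either removes a single token from any one nonempty pile, or selects two different nonempty piles and removes one token from each of those two. The last player to move wins. A position is a $\mathcal{P}$-position if the player who is not about to move has a winning strategy, equivalently if none of its options (positions reachable in one move) is a $\mathcal{P}$-position; otherwise it is an $\mathcal{N}$-position. Here $a_1,a_2,a_3$ are nonnegative integers. *)

theory Defs
  imports "HOL-Library.Multiset" "HOL-Number_Theory.Cong"
begin

text \<open>A position is the multiset of its pile sizes. A pile that has been emptied stays
  in the multiset as an entry 0; it admits no move and so plays no further role.\<close>

type_synonym position = "nat multiset"

text \<open>In \<open>two\<close> the piles are distinct entries of the multiset; their sizes may coincide.\<close>

inductive version_c_move :: "position \<Rightarrow> position \<Rightarrow> bool" where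
  one: "version_c_move (add_mset (Suc m) R) (add_mset m R)"
| two: "version_c_move (add_mset (Suc m) (add_mset (Suc n) R)) (add_mset m (add_mset n R))"

definition options :: "position \<Rightarrow> position set" where
  "options p = {q. version_c_move p q}"

lemma sum_mset_option_less: "q \<in> options p \<Longrightarrow> sum_mset q < sum_mset p"
  by (auto simp: options_def elim: version_c_move.cases)

text \<open>The last player to move wins, so a position without options is a P-position.\<close>

function P_position :: "position \<Rightarrow> bool" where
  "P_position p \<longleftrightarrow> (\<forall>q\<in>options p. \<not> P_position q)"
  by auto
termination
  by (relation "measure sum_mset") (auto dest: sum_mset_option_less)

declare P_position.simps [simp del]

end

theory Submission
  imports Defs
begin

text \<open>The P-positions form the kernel of the move graph: no move joins two of them, and every
  other position has a move into them. Modulo 3, taking one token lowers \<open>a1 + 2 * a2\<close> by 1 and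
  taking two lowers it by 2, so the zero residue class is a kernel except near the boundary, where
  the move that the residue calls for may be unavailable or may end in an exception. Both kernel
  properties are periodic in the numbers of piles from a small bound on, which leaves finitely
  many cases.\<close>

text \<open>The digits in a rule name are the sizes of the piles that lose a token.\<close>

inductive count_move :: "nat \<Rightarrow> nat \<Rightarrow> nat \<Rightarrow> nat \<Rightarrow> nat \<Rightarrow> nat \<Rightarrow> bool" where
  m1: "count_move (Suc a) b c a b c"
| m2: "count_move a (Suc b) c (Suc a) b c"
| m3: "count_move a b (Suc c) a (Suc b) c"
| m11: "count_move (Suc (Suc a)) b c a b c"
| m12: "count_move (Suc a) (Suc b) c (Suc a) b c"
| m13: "count_move (Suc a) b (Suc c) a (Suc b) c"
| m22: "count_move a (Suc (Suc b)) c (Suc (Suc a)) b c"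
| m23: "count_move a (Suc b) (Suc c) (Suc a) (Suc b) c"
| m33: "count_move a b (Suc (Suc c)) a (Suc (Suc b)) c"

section \<open>Moves on piles as moves on counts\<close>

text \<open>The bound 3 leaves only 0, 1 and 2 as sizes of a pile that has just lost a token, so
  three rules for one pile and, up to order, six for two piles cover every move. An emptied pile
  becomes an entry 0 and drops out of the counts.\<close>

lemma count_move_if_version_c_move:
  assumes "version_c_move p q" and "\<forall>x\<in>#p. x \<le> 3"
  shows "count_move (count p 1) (count p 2) (count p 3) (count q 1) (count q 2) (count q 3)"
    and "\<forall>x\<in>#q. x \<le> 3"
proof -
  have small: "m = 0 \<or> m = 1 \<or> m = 2" if "Suc m \<le> 3" for m :: nat
    using that by auto
  show "count_move (count p 1) (count p 2) (count p 3) (count q 1) (count q 2) (count q 3)"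
    using assms
  proof cases
    case (one m R)
    then have "m = 0 \<or> m = 1 \<or> m = 2" using assms small by auto
    then show ?thesis using one by (auto intro: count_move.intros)
  next
    case (two m n R)
    then have "m = 0 \<or> m = 1 \<or> m = 2" "n = 0 \<or> n = 1 \<or> n = 2" using assms small by auto
    then show ?thesis using two by (auto intro: count_move.intros)
  qed
  show "\<forall>x\<in>#q. x \<le> 3"
    using assms by cases auto
qed

lemma version_c_move_one: "Suc m \<in># p \<Longrightarrow> version_c_move p (add_mset m (p - {#Suc m#}))"
  by (metis insert_DiffM version_c_move.one)

lemma version_c_move_two:
  assumes "{#Suc m, Suc n#} \<subseteq># p"
  shows "version_c_move p (add_mset m (add_mset n (p - {#Suc m, Suc n#})))"
proof -
  have "p = add_mset (Suc m) (add_mset (Suc n) (p - {#Suc m, Suc n#}))"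
    using subset_mset.add_diff_inverse[OF assms] by simp
  then show ?thesis
    by (metis version_c_move.two)
qed

text \<open>The witness lowers exactly the piles named by the digits of the rule; the successors in
  the rule guarantee that these piles exist, with multiplicity two in \<open>m11\<close>,
  \<open>m22\<close> and \<open>m33\<close>.\<close>

lemma version_c_move_if_count_move:
  assumes "count_move (count p 1) (count p 2) (count p 3) a b c"
  obtains q where "version_c_move p q" and "count q 1 = a" "count q 2 = b" "count q 3 = c"
proof -
  have "\<exists>q. version_c_move p q \<and> count q 1 = a \<and> count q 2 = b \<and> count q 3 = c"
    using assms
  proof cases
    case m1
    then show ?thesis
      by (intro exI[of _ "add_mset 0 (p - {#1#})"])
        (use version_c_move_one[of 0 p] in \<open>auto simp flip: count_greater_zero_iff\<close>)
  next
    case m2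
    then show ?thesis
      by (intro exI[of _ "add_mset 1 (p - {#2#})"])
        (use version_c_move_one[of 1 p] in \<open>auto simp: numeral_2_eq_2 simp flip: count_greater_zero_iff\<close>)
  next
    case m3
    then show ?thesis
      by (intro exI[of _ "add_mset 2 (p - {#3#})"])
        (use version_c_move_one[of 2 p] in \<open>auto simp flip: count_greater_zero_iff\<close>)
  next
    case m11
    then show ?thesis
      by (intro exI[of _ "add_mset 0 (add_mset 0 (p - {#1, 1#}))"])
        (use version_c_move_two[of 0 0 p] in \<open>auto simp: subseteq_mset_def\<close>)
  next
    case m12
    then show ?thesis
      by (intro exI[of _ "add_mset 0 (add_mset 1 (p - {#1, 2#}))"])
        (use version_c_move_two[of 0 1 p] in \<open>auto simp: subseteq_mset_def simp flip: numeral_2_eq_2\<close>)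
  next
    case m13
    then show ?thesis
      by (intro exI[of _ "add_mset 0 (add_mset 2 (p - {#1, 3#}))"])
        (use version_c_move_two[of 0 2 p] in \<open>auto simp: subseteq_mset_def\<close>)
  next
    case m22
    then show ?thesis
      by (intro exI[of _ "add_mset 1 (add_mset 1 (p - {#2, 2#}))"])
        (use version_c_move_two[of 1 1 p] in \<open>auto simp: subseteq_mset_def simp flip: numeral_2_eq_2\<close>)
  next
    case m23
    then show ?thesis
      by (intro exI[of _ "add_mset 1 (add_mset 2 (p - {#2, 3#}))"])
        (use version_c_move_two[of 1 2 p] in \<open>auto simp: subseteq_mset_def simp flip: numeral_2_eq_2\<close>)
  next
    case m33
    then show ?thesis
      by (intro exI[of _ "add_mset 2 (add_mset 2 (p - {#3, 3#}))"])
        (use version_c_move_two[of 2 2 p] in \<open>auto simp: subseteq_mset_def\<close>)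
  qed
  then show ?thesis using that by blast
qed

section \<open>The candidate set of P-positions\<close>

text \<open>With piles of size 2 only, the second player wins by emptying the piles just lowered to
  1. The infinite families of exceptions are the positions of residue zero with a move to such a
  position; each of the ten single exceptions has a move to one of the five triples in the second
  clause. Residues of \<open>b\<close> replace the parameter of the families, to avoid
  quantifiers.\<close>

definition kernel :: "nat \<Rightarrow> nat \<Rightarrow> nat \<Rightarrow> bool" where
  "kernel a b c \<longleftrightarrow>
      (a = 0 \<and> c = 0)
    \<or> (a, b, c) \<in> {(0,1,3), (0,2,3), (1,0,2), (1,0,5), (2,0,1)}
    \<or> ((a + 2 * b) mod 3 = 0 \<and>
       \<not> (a = 0 \<and> b mod 3 = 0 \<and> c \<in> {1,2}
         \<or> a = 1 \<and> b mod 3 = 1 \<and> c \<in> {0,1}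
         \<or> a = 2 \<and> b mod 3 = 2 \<and> c = 0
         \<or> (a, b, c) \<in> {(0,0,4), (0,0,5), (1,1,2), (1,1,3), (1,1,4), (1,1,5),
                         (2,2,3), (3,0,1), (3,0,2), (3,0,5)}))"

text \<open>One slice for each small number of piles of size 1, with that number in
  \<open>Suc\<close> form so that the slices rewrite the results of the case splits below.\<close>

lemma kernel_0: "kernel 0 b c \<longleftrightarrow> c = 0 \<or> c = 3 \<and> (b = 1 \<or> b = 2)
    \<or> b mod 3 = 0 \<and> c \<ge> 3 \<and> \<not> (b = 0 \<and> (c = 4 \<or> c = 5))"
  unfolding kernel_def by (simp; presburger)

lemma kernel_1: "kernel (Suc 0) b c \<longleftrightarrow> b = 0 \<and> (c = 2 \<or> c = 5)
    \<or> b mod 3 = 1 \<and> c \<ge> 2 \<and> \<not> (b = 1 \<and> c \<le> 5)"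
  unfolding kernel_def by (simp; presburger)

lemma kernel_2: "kernel (Suc (Suc 0)) b c \<longleftrightarrow> b = 0 \<and> c = 1
    \<or> b mod 3 = 2 \<and> c \<noteq> 0 \<and> \<not> (b = 2 \<and> c = 3)"
  unfolding kernel_def by (simp; presburger)

lemma kernel_3: "kernel (Suc (Suc (Suc 0))) b c \<longleftrightarrow>
    b mod 3 = 0 \<and> \<not> (b = 0 \<and> (c = 1 \<or> c = 2 \<or> c = 5))"
  unfolding kernel_def by (simp; presburger)

text \<open>Every special clause has at most three piles of size 1, so only the residue condition
  remains; modulo 3, \<open>2 * b\<close> is the negative of \<open>b\<close>.\<close>

lemma kernel_ge_4: "kernel (Suc (Suc (Suc (Suc a)))) b c \<longleftrightarrow> b mod 3 = Suc a mod 3"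
  unfolding kernel_def by (simp; presburger)

lemma mod_3_simps:
  fixes k n :: nat
  shows "Suc (3 * k) mod 3 = 1" and "Suc (Suc (3 * k)) mod 3 = 2"
    and "Suc (Suc (Suc n)) mod 3 = n mod 3"
  by presburger+

lemmas kernel_simps = kernel_0 kernel_1 kernel_2 kernel_3 kernel_ge_4 mod_3_simps

lemma nat_cases3: obtains "n = 0" | "n = Suc 0" | m where "n = Suc (Suc m)"
  by (metis not0_implies_Suc)

text \<open>Meant for \<open>b\<close>: a move takes at most two piles of size 2, so 0 and 1 stand
  alone, and from 2 on each residue class has enough \<open>Suc\<close> to subtract from.\<close>

lemma nat_cases_mod_3:
  fixes n :: nat
  obtains "n = 0" | "n = Suc 0"
    | k where "n = Suc (Suc (3 * k))" | k where "n = Suc (Suc (Suc (3 * k)))"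
    | k where "n = Suc (Suc (Suc (Suc (3 * k))))"
proof -
  have "n = 0 \<or> n = Suc 0 \<or> (\<exists>k. n = Suc (Suc (3 * k))) \<or> (\<exists>k. n = Suc (Suc (Suc (3 * k))))
      \<or> (\<exists>k. n = Suc (Suc (Suc (Suc (3 * k)))))"
    by presburger
  then show thesis
    using that by blast
qed

text \<open>Meant for \<open>a\<close>: from 6 on, losing two piles of size 1 still leaves at least
  four, so \<open>kernel_ge_4\<close> applies before and after the move.\<close>

lemma nat_cases_ge_6_mod_3:
  fixes n :: nat
  obtains "n = 0" | "n = Suc 0" | "n = Suc (Suc 0)"
    | "n = Suc (Suc (Suc 0))" | "n = Suc (Suc (Suc (Suc 0)))"
    | "n = Suc (Suc (Suc (Suc (Suc 0))))"
    | k where "n = Suc (Suc (Suc (Suc (Suc (Suc (3 * k))))))"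
    | k where "n = Suc (Suc (Suc (Suc (Suc (Suc (Suc (3 * k)))))))"
    | k where "n = Suc (Suc (Suc (Suc (Suc (Suc (Suc (Suc (3 * k))))))))"
proof -
  have "n = 0 \<or> n = Suc 0 \<or> n = Suc (Suc 0) \<or> n = Suc (Suc (Suc 0)) \<or> n = Suc (Suc (Suc (Suc 0))) \<or> n = Suc (Suc (Suc (Suc (Suc 0))))
      \<or> (\<exists>k. n = Suc (Suc (Suc (Suc (Suc (Suc (3 * k)))))))
      \<or> (\<exists>k. n = Suc (Suc (Suc (Suc (Suc (Suc (Suc (3 * k))))))))
      \<or> (\<exists>k. n = Suc (Suc (Suc (Suc (Suc (Suc (Suc (Suc (3 * k)))))))))"
    by presburger
  then show thesis
    using that by blast
qed

section \<open>The two kernel properties\<close>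

text \<open>Every move changes the residue, so the critical moves are those with an end among the
  kernel positions of nonzero residue: some with \<open>a = c = 0\<close>, and the five sporadic
  ones.\<close>

lemma kernel_independent:
  assumes "count_move a b c a' b' c'" and "kernel a b c"
  shows "\<not> kernel a' b' c'"
  using assms
proof cases
  case m1
  with assms(2) show ?thesis
    \<comment> \<open>No split on \<open>c\<close>: the slices only compare it with
      constants.\<close>
    by - (hypsubst, cases a' rule: nat_cases_ge_6_mod_3; hypsubst; cases b rule: nat_cases_mod_3; hypsubst;
      simp add: kernel_simps; presburger?)
next
  case m2
  with assms(2) show ?thesis
    by - (hypsubst, cases a rule: nat_cases_ge_6_mod_3; hypsubst; cases b' rule: nat_cases_mod_3; hypsubst;
      simp add: kernel_simps; presburger?)
next
  case m3
  with assms(2) show ?thesis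
    by - (hypsubst, cases a rule: nat_cases_ge_6_mod_3; hypsubst; cases b rule: nat_cases_mod_3; hypsubst;
      simp add: kernel_simps; presburger?)
next
  case m11
  with assms(2) show ?thesis
    by - (hypsubst, cases a' rule: nat_cases_ge_6_mod_3; hypsubst; cases b rule: nat_cases_mod_3; hypsubst;
      simp add: kernel_simps; presburger?)
next
  case (m12 k)
  with assms(2) show ?thesis
    by - (hypsubst, cases k rule: nat_cases_ge_6_mod_3; hypsubst; cases b' rule: nat_cases_mod_3; hypsubst;
      simp add: kernel_simps; presburger?)
next
  case m13
  with assms(2) show ?thesis
    by - (hypsubst, cases a' rule: nat_cases_ge_6_mod_3; hypsubst; cases b rule: nat_cases_mod_3; hypsubst;
      simp add: kernel_simps; presburger?)
next
  case m22
  with assms(2) show ?thesis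
    by - (hypsubst, cases a rule: nat_cases_ge_6_mod_3; hypsubst; cases b' rule: nat_cases_mod_3; hypsubst;
      simp add: kernel_simps; presburger?)
next
  case (m23 k)
  with assms(2) show ?thesis
    by - (hypsubst, cases a rule: nat_cases_ge_6_mod_3; hypsubst; cases k rule: nat_cases_mod_3; hypsubst;
      simp add: kernel_simps; presburger?)
next
  case m33
  with assms(2) show ?thesis
    by - (hypsubst, cases a rule: nat_cases_ge_6_mod_3; hypsubst; cases b rule: nat_cases_mod_3; hypsubst;
      simp add: kernel_simps; presburger?)
qed

text \<open>One disjunct per rule of \<open>count_move\<close>, in the same order, with guards that
  make the truncated subtractions exact. This form replaces the search for an option by
  arithmetic.\<close>

lemma kernel_option_exists_if:
  assumes "(a \<ge> 1 \<and> kernel (a - 1) b c)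
    \<or> (b \<ge> 1 \<and> kernel (Suc a) (b - 1) c)
    \<or> (c \<ge> 1 \<and> kernel a (Suc b) (c - 1))
    \<or> (a \<ge> 2 \<and> kernel (a - 2) b c)
    \<or> (a \<ge> 1 \<and> b \<ge> 1 \<and> kernel a (b - 1) c)
    \<or> (a \<ge> 1 \<and> c \<ge> 1 \<and> kernel (a - 1) (Suc b) (c - 1))
    \<or> (b \<ge> 2 \<and> kernel (Suc (Suc a)) (b - 2) c)
    \<or> (b \<ge> 1 \<and> c \<ge> 1 \<and> kernel (Suc a) b (c - 1))
    \<or> (c \<ge> 2 \<and> kernel a (Suc (Suc b)) (c - 2))"
  shows "\<exists>a' b' c'. count_move a b c a' b' c' \<and> kernel a' b' c'"
  using assms
  by (cases a rule: nat_cases3; cases b rule: nat_cases3; cases c rule: nat_cases3;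
      simp; blast intro: count_move.intros)

lemma kernel_absorbing:
  assumes "\<not> kernel a b c"
  shows "\<exists>a' b' c'. count_move a b c a' b' c' \<and> kernel a' b' c'"
proof -
  have "kernel a b c
    \<or> (a \<ge> 1 \<and> kernel (a - 1) b c)
    \<or> (b \<ge> 1 \<and> kernel (Suc a) (b - 1) c)
    \<or> (c \<ge> 1 \<and> kernel a (Suc b) (c - 1))
    \<or> (a \<ge> 2 \<and> kernel (a - 2) b c)
    \<or> (a \<ge> 1 \<and> b \<ge> 1 \<and> kernel a (b - 1) c)
    \<or> (a \<ge> 1 \<and> c \<ge> 1 \<and> kernel (a - 1) (Suc b) (c - 1))
    \<or> (b \<ge> 2 \<and> kernel (Suc (Suc a)) (b - 2) c)
    \<or> (b \<ge> 1 \<and> c \<ge> 1 \<and> kernel (Suc a) b (c - 1))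
    \<or> (c \<ge> 2 \<and> kernel a (Suc (Suc b)) (c - 2))"
    \<comment> \<open>Here \<open>c\<close> is split as well, since whether one or two piles of size
      3 are available decides the guards.\<close>
    by (cases a rule: nat_cases_ge_6_mod_3; hypsubst; cases b rule: nat_cases_mod_3; hypsubst;
        cases c rule: nat_cases3; hypsubst; simp add: kernel_simps; presburger?)
  then show ?thesis
    using assms by (blast intro: kernel_option_exists_if)
qed

section \<open>Transfer to the game\<close>

lemma P_position_iff_kernel:
  assumes "\<forall>x\<in>#p. x \<le> 3"
  shows "P_position p \<longleftrightarrow> kernel (count p 1) (count p 2) (count p 3)"
  using assms
proof (induction "sum_mset p" arbitrary: p rule: less_induct)
  case less
  have IH: "P_position q \<longleftrightarrow> kernel (count q 1) (count q 2) (count q 3)"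
    if "version_c_move p q" for q
  proof (rule less.hyps)
    show "sum_mset q < sum_mset p"
      using that by (simp add: sum_mset_option_less options_def)
    show "\<forall>x\<in>#q. x \<le> 3"
      using that less.prems by (rule count_move_if_version_c_move)
  qed
  show ?case
  proof
    assume P: "P_position p"
    show "kernel (count p 1) (count p 2) (count p 3)"
    proof (rule ccontr)
      assume "\<not> ?thesis"
      then obtain a b c where "count_move (count p 1) (count p 2) (count p 3) a b c"
        and "kernel a b c"
        using kernel_absorbing by blast
      then obtain q where "version_c_move p q" "P_position q"
        using version_c_move_if_count_move IH by metis
      then show False
        using P P_position.simps[of p] by (auto simp: options_def)
    qed
  next
    assume "kernel (count p 1) (count p 2) (count p 3)"
    then have "\<not> P_position q" if "version_c_move p q" for q
      using that IH kernel_independent count_move_if_version_c_move(1)[OF that less.prems] by blast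
    then show "P_position p"
      by (subst P_position.simps) (auto simp: options_def)
  qed
qed

theorem lemma3p3:
  fixes p :: position and a1 a2 a3 :: nat
  assumes "\<forall>x\<in>#p. x \<le> 3"
    and "count p 1 = a1" and "count p 2 = a2" and "count p 3 = a3"
  shows "P_position p \<longleftrightarrow>
      (a1 = 0 \<and> a3 = 0)
    \<or> (a1, a2, a3) \<in> {(0,1,3), (0,2,3), (1,0,2), (1,0,5), (2,0,1)}
    \<or> ([a1 + 2 * a2 = 0] (mod 3) \<and>
       \<not> ((\<exists>k. \<exists>j\<in>{1,2}. (a1, a2, a3) = (0, 3 * k, j))
         \<or> (\<exists>k. \<exists>j\<in>{0,1}. (a1, a2, a3) = (1, 3 * k + 1, j))
         \<or> (\<exists>k. (a1, a2, a3) = (2, 3 * k + 2, 0))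
         \<or> (a1, a2, a3) \<in> {(0,0,4), (0,0,5), (1,1,2), (1,1,3), (1,1,4), (1,1,5),
                             (2,2,3), (3,0,1), (3,0,2), (3,0,5)}))"
proof -
  \<comment> \<open>The bound on \<open>r\<close> makes it the remainder of \<open>a2\<close>. A
    general \<open>J\<close> covers the third family too, with the singleton
    \<open>{0}\<close>.\<close>
  have family: "(\<exists>k. \<exists>j\<in>J. (a1, a2, a3) = (m, 3 * k + r, j))
      \<longleftrightarrow> a1 = m \<and> a2 mod 3 = r \<and> a3 \<in> J" if "r < 3" for m r :: nat and J
  proof -
    have "(\<exists>k. a2 = 3 * k + r) \<longleftrightarrow> a2 mod 3 = r"
      using that by presburger
    then show ?thesis by auto
  qed
  from family[of 0 "{1,2}" 0] family[of 1 "{0,1}" 1] family[of 2 "{0}" 2]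
  have "(\<exists>k. \<exists>j\<in>{1,2}. (a1, a2, a3) = (0, 3 * k, j)) \<longleftrightarrow> a1 = 0 \<and> a2 mod 3 = 0 \<and> a3 \<in> {1,2}"
    and "(\<exists>k. \<exists>j\<in>{0,1}. (a1, a2, a3) = (1, 3 * k + 1, j)) \<longleftrightarrow> a1 = 1 \<and> a2 mod 3 = 1 \<and> a3 \<in> {0,1}"
    and "(\<exists>k. (a1, a2, a3) = (2, 3 * k + 2, 0)) \<longleftrightarrow> a1 = 2 \<and> a2 mod 3 = 2 \<and> a3 = 0"
    by simp_all
  moreover have "P_position p \<longleftrightarrow> kernel a1 a2 a3"
    using P_position_iff_kernel[OF assms(1)] assms(2-4) by simp
  ultimately show ?thesis
    unfolding kernel_def cong_def by (simp only: mod_0)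
qed

end
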